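(* Let $m\ge 2$ and $n\ge 1$ be integers, let $\mathcal S$ be a real symmetric tensor of order $m$ and dimension $n$, and let $(\lambda,\mathbf v)$ be a real eigenpair of $\mathcal S$. If $(\lambda,\mathbf v)$ is robust, then $\mathbf v$ is a locally maximal solution of the constrained optimization problem $\max_{\mathbf u\in\mathbb R^n}\ \mathcal S\mathbf u^{m}$ subject to $\mathbf u^{\mathrm T}\mathbf u=1$. The converse does not always hold: there exist a real symmetric tensor $\mathcal S$ and an eigenpair $(\lambda,\mathbf v)$ of $\mathcal S$ such that $\mathbf v$ is a locally maximal solution of this problem but $(\lambda,\mathbf v)$ is not robust.
   Context: For a real symmetric tensor $\mathcal S=(s_{i_1,\dots,i_m})$ of order $m$ and dimension $n$ (entries invariant under permutation of indices) and $\mathbf v\in\mathbb R^n$: $\mathcal S\mathbf v^m=\sum_{i_1,\dots,i_m=1}^n s_{i_1,\dots,i_m}v_{i_1}\cdots v_{i_m}$; $\mathcal S\mathbf v^{m-1}\in\mathbb R^n$ has $j$th entry $\sum_{i_2,\dots,i_m=1}^n s_{j,i_2,\dots,i_m}v_{i_2}\cdots v_{i_m}$; $\mathcal S\mathbf v^{m-2}\in\mathbb R^{n\times n}$ has $(i,j)$ entry $\sum_{i_3,\dots,i_m=1}^n s_{i,j,i_3,\dots,i_m}v_{i_3}\cdots v_{i_m}$. A (real) eigenpair of $\mathcal S$ is a pair $(\lambda,\mathbf v)\in\mathbb R\times\mathbb R^n$ with $\mathcal S\mathbf v^{m-1}=\lambda\mathbf v$ and $\mathbf v^{\mathrm T}\mathbf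 v=1$. Robustness: the tensor power method iterates the map $\phi(\mathbf v)=\mathcal S\mathbf v^{m-1}/\|\mathcal S\mathbf v^{m-1}\|$. An eigenpair $(\lambda,\mathbf v)$ with $\lambda\neq0$ is called robust if $\mathbf v$ is an attracting fixed point of $\phi$, meaning that $\phi(\mathbf v)=\mathbf v$ (equivalently $\lambda>0$) and the Jacobian matrix of $\phi$ at $\mathbf v$, namely $\mathbf J(\mathbf v)=\frac{m-1}{\lambda}\left(\mathcal S\mathbf v^{m-2}-\lambda\mathbf v\mathbf v^{\mathrm T}\right)$, has spectral radius (maximum absolute value of its eigenvalues) strictly less than $1$. A locally maximal solution of the constrained problem is a unit vector $\mathbf v$ such that $\mathcal S\mathbf u^m\le\mathcal S\mathbf v^m$ for all unit vectors $\mathbf u$ in some neighbourhood of $\mathbf v$. *)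

theory Defs
  imports "Jordan_Normal_Form.Spectral_Radius"
begin

text \<open>
  The order \<open>m\<close> and the dimension \<open>n\<close> have to be quantified inside the theorem, so the vectors
  and matrices are those of \<^theory>\<open>Jordan_Normal_Form.Matrix\<close>. A tensor maps index lists to
  its entries; only its values on \<open>tensor_indices n m\<close> matter. Indices are zero-based.
\<close>

type_synonym tensor = "nat list \<Rightarrow> real"

definition tensor_indices :: "nat \<Rightarrow> nat \<Rightarrow> nat list set" where
  "tensor_indices n m = {is. length is = m \<and> set is \<subseteq> {..<n}}"

definition symmetric_tensor :: "nat \<Rightarrow> nat \<Rightarrow> tensor \<Rightarrow> bool" where
  "symmetric_tensor m n S \<longleftrightarrow>
     (\<forall>is \<in> tensor_indices n m. \<forall>js \<in> tensor_indices n m. mset is = mset js \<longrightarrow> S is = S js)"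

text \<open>
  The following three are \<open>S v\<^sup>m\<close>, \<open>S v\<^sup>m\<^sup>-\<^sup>1\<close> and \<open>S v\<^sup>m\<^sup>-\<^sup>2\<close>. The differences \<open>m - 1\<close> and \<open>m - 2\<close>
  are truncated, so the definitions are meant for \<open>m \<ge> 1\<close> and \<open>m \<ge> 2\<close> respectively.
\<close>

definition tensor_form :: "nat \<Rightarrow> nat \<Rightarrow> tensor \<Rightarrow> real vec \<Rightarrow> real" where
  "tensor_form m n S v = (\<Sum>is \<in> tensor_indices n m. S is * (\<Prod>i\<leftarrow>is. v $ i))"

definition tensor_vec :: "nat \<Rightarrow> nat \<Rightarrow> tensor \<Rightarrow> real vec \<Rightarrow> real vec" where
  "tensor_vec m n S v =
     vec n (\<lambda>j. \<Sum>is \<in> tensor_indices n (m - 1). S (j # is) * (\<Prod>i\<leftarrow>is. v $ i))"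

definition tensor_mat :: "nat \<Rightarrow> nat \<Rightarrow> tensor \<Rightarrow> real vec \<Rightarrow> real mat" where
  "tensor_mat m n S v =
     mat n n (\<lambda>(i, j). \<Sum>is \<in> tensor_indices n (m - 2). S (i # j # is) * (\<Prod>k\<leftarrow>is. v $ k))"

definition eigenpair :: "nat \<Rightarrow> nat \<Rightarrow> tensor \<Rightarrow> real \<Rightarrow> real vec \<Rightarrow> bool" where
  "eigenpair m n S l v \<longleftrightarrow>
     v \<in> carrier_vec n \<and> tensor_vec m n S v = l \<cdot>\<^sub>v v \<and> v \<bullet> v = 1"

definition eucl_norm :: "real vec \<Rightarrow> real" where
  "eucl_norm v = sqrt (v \<bullet> v)"

definition power_map :: "nat \<Rightarrow> nat \<Rightarrow> tensor \<Rightarrow> real vec \<Rightarrow> real vec" where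
  "power_map m n S v = (1 / eucl_norm (tensor_vec m n S v)) \<cdot>\<^sub>v tensor_vec m n S v"

text \<open>
  The Jacobian matrix of \<open>power_map m n S\<close> at \<open>v\<close>, in the closed form
  \<open>(m - 1) / l (S v\<^sup>m\<^sup>-\<^sup>2 - l v v\<^sup>T)\<close> that it takes when \<open>(l, v)\<close> is an eigenpair with \<open>l > 0\<close>.
\<close>

definition power_map_jacobian :: "nat \<Rightarrow> nat \<Rightarrow> tensor \<Rightarrow> real \<Rightarrow> real vec \<Rightarrow> real mat" where
  "power_map_jacobian m n S l v =
     ((real m - 1) / l) \<cdot>\<^sub>m (tensor_mat m n S v - l \<cdot>\<^sub>m mat n n (\<lambda>(i, j). v $ i * v $ j))"

text \<open>The library defines the spectral radius for complex matrices only, hence the embedding.\<close>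

definition robust :: "nat \<Rightarrow> nat \<Rightarrow> tensor \<Rightarrow> real \<Rightarrow> real vec \<Rightarrow> bool" where
  "robust m n S l v \<longleftrightarrow>
     eigenpair m n S l v \<and> l \<noteq> 0 \<and> power_map m n S v = v \<and>
     spectral_radius (map_mat complex_of_real (power_map_jacobian m n S l v)) < 1"

definition locally_maximal :: "nat \<Rightarrow> nat \<Rightarrow> tensor \<Rightarrow> real vec \<Rightarrow> bool" where
  "locally_maximal m n S v \<longleftrightarrow>
     v \<in> carrier_vec n \<and> v \<bullet> v = 1 \<and>
     (\<exists>e>0. \<forall>u \<in> carrier_vec n. u \<bullet> u = 1 \<longrightarrow> eucl_norm (u - v) < e \<longrightarrow>
        tensor_form m n S u \<le> tensor_form m n S v)"

end

theory Submission
  imports Defs "HOL-Analysis.L2_Norm"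
begin

text \<open>
  Let \<open>(l, v)\<close> be robust, \<open>J\<close> the Jacobian at \<open>v\<close>, and \<open>A = S v\<^sup>m\<^sup>-\<^sup>2\<close>. Expand \<open>S u\<^sup>m\<close> at \<open>v\<close> with
  \<open>h = u - v\<close>. For unit vectors the first-order term does not vanish but is of second order,
  \<open>S v\<^sup>m\<^sup>-\<^sup>1 \<bullet> h = l (v \<bullet> h) = - l |h|\<^sup>2 / 2\<close>, so up to a remainder of order \<open>|h|\<^sup>3\<close>

    \<open>S u\<^sup>m - S v\<^sup>m = m / 2 * ((m - 1) (h \<bullet> A h) - l |h|\<^sup>2)\<close>.

  By the formula for \<open>J\<close>, \<open>(m - 1) (h \<bullet> A h)\<close> equals \<open>l (h \<bullet> J h)\<close> up to a multiple of
  \<open>(v \<bullet> h)\<^sup>2 = |h|\<^sup>4 / 4\<close>. Since \<open>J\<close> is symmetric, a spectral radius below one gives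
  \<open>h \<bullet> J h \<le> r |h|\<^sup>2\<close> for some \<open>r < 1\<close>; since \<open>l > 0\<close>, the leading term is then at most
  \<open>- m l (1 - r) |h|\<^sup>2 / 2\<close>, which dominates the remainder near \<open>v\<close>.

  The bound on \<open>h \<bullet> J h\<close> (\<open>symmetric_spectral_radius_less_one_form\<close>) is obtained without
  diagonalizing \<open>J\<close>: a spectral radius below one makes the powers of \<open>J\<close> bounded, whereas for a
  symmetric matrix the sequence \<open>|J\<^sup>k h|\<close> is logarithmically convex, so that it would grow
  geometrically as soon as \<open>|J h| > |h|\<close>. The expansion (\<open>tensor_form_expansion\<close>) is the
  binomial theorem for symmetric multilinear forms.

  For the failure of the converse, take the identity matrix as a tensor of order two: its form is
  constant on the unit sphere, so every unit vector is a maximum, but the power map is the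
  identity on the sphere and attracts nothing.
\<close>

section \<open>The Euclidean norm\<close>

lemma eucl_norm_L2_set: "eucl_norm v = L2_set (\<lambda>i. v $ i) {0..<dim_vec v}"
  by (simp add: eucl_norm_def L2_set_def scalar_prod_def power2_eq_square)

lemma eucl_norm_nonneg [simp]: "0 \<le> eucl_norm v"
  by (simp add: eucl_norm_L2_set L2_set_nonneg)

lemma eucl_norm_square: "(eucl_norm v)\<^sup>2 = v \<bullet> v"
  by (simp add: eucl_norm_def scalar_prod_def sum_nonneg)

lemma abs_index_le_eucl_norm:
  assumes "i < dim_vec v"
  shows "\<bar>v $ i\<bar> \<le> eucl_norm v"
proof -
  have "\<bar>v $ i\<bar> = sqrt ((v $ i)\<^sup>2)" by simp
  also have "\<dots> \<le> L2_set (\<lambda>i. v $ i) {0..<dim_vec v}"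
    unfolding L2_set_def using assms
    by (intro real_sqrt_le_mono member_le_sum[where f = "\<lambda>i. (v $ i)\<^sup>2"]) auto
  finally show ?thesis by (simp add: eucl_norm_L2_set)
qed

lemma scalar_prod_le_eucl_norm:
  assumes "x \<in> carrier_vec n" and "y \<in> carrier_vec n"
  shows "x \<bullet> y \<le> eucl_norm x * eucl_norm y"
proof -
  have "x \<bullet> y \<le> (\<Sum>i = 0..<n. \<bar>x $ i\<bar> * \<bar>y $ i\<bar>)"
    unfolding scalar_prod_def using assms by (auto intro!: sum_mono simp flip: abs_mult)
  also have "\<dots> \<le> eucl_norm x * eucl_norm y"
    using L2_set_mult_ineq[of "\<lambda>i. x $ i" "\<lambda>i. y $ i" "{0..<n}"] assms
    by (simp add: eucl_norm_L2_set)
  finally show ?thesis .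
qed

lemma eucl_norm_smult: "eucl_norm (c \<cdot>\<^sub>v v) = \<bar>c\<bar> * eucl_norm v"
proof -
  have "(c \<cdot>\<^sub>v v) \<bullet> (c \<cdot>\<^sub>v v) = c\<^sup>2 * (v \<bullet> v)"
    by (simp add: scalar_prod_def sum_distrib_left power2_eq_square algebra_simps)
  then show ?thesis by (simp add: eucl_norm_def real_sqrt_mult)
qed

section \<open>Symmetric matrices whose spectral radius is below one\<close>

lemma smult_mat_mult_vec:
  fixes A :: "'a::comm_semiring_0 mat"
  shows "v \<in> carrier_vec (dim_col A) \<Longrightarrow> (c \<cdot>\<^sub>m A) *\<^sub>v v = c \<cdot>\<^sub>v (A *\<^sub>v v)"
  by (intro eq_vecI) (auto simp: scalar_prod_def sum_distrib_left algebra_simps)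

text \<open>
  By log-convexity the quotients \<open>a (k + 1) / a k\<close> are nondecreasing, so if the first one exceeds
  one then \<open>a\<close> grows at least geometrically.
\<close>

lemma log_convex_bounded_imp_le:
  fixes a :: "nat \<Rightarrow> real"
  assumes nonneg: "\<And>k. 0 \<le> a k"
    and log_convex: "\<And>k. (a (Suc k))\<^sup>2 \<le> a k * a (Suc (Suc k))"
    and bounded: "\<And>k. a k \<le> K"
  shows "a 1 \<le> a 0"
proof (rule ccontr)
  assume "\<not> a 1 \<le> a 0"
  then have less: "a 0 < a 1" by simp
  have "a 0 \<noteq> 0"
    using log_convex[of 0] less by auto
  then have pos: "0 < a 0" using nonneg[of 0] by simp
  define q where "q = a 1 / a 0"
  have q: "1 < q" using less pos by (simp add: q_def)
  have step: "0 < a k \<and> q * a k \<le> a (Suc k)" for k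
  proof (induction k)
    case 0
    then show ?case using pos by (simp add: q_def)
  next
    case (Suc k)
    have pos': "0 < a (Suc k)"
      using Suc q by (smt (verit) mult_pos_pos)
    have "a k * (q * a (Suc k)) \<le> a (Suc k) * a (Suc k)"
      using Suc pos' by (simp add: mult.commute mult.left_commute mult_left_mono)
    also have "\<dots> \<le> a k * a (Suc (Suc k))"
      using log_convex[of k] by (simp add: power2_eq_square)
    finally have "q * a (Suc k) \<le> a (Suc (Suc k))"
      using Suc by (simp add: mult_le_cancel_left_pos)
    then show ?case using pos' by simp
  qed
  have growth: "q ^ k * a 0 \<le> a k" for k
  proof (induction k)
    case (Suc k)
    have "q ^ Suc k * a 0 \<le> q * a k"
      using Suc q by (simp add: mult.assoc mult_left_mono)
    then show ?case using step[of k] by linarith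
  qed simp
  obtain k where "K / a 0 < q ^ k"
    using q real_arch_pow by blast
  then have "K < q ^ k * a 0" using pos by (simp add: pos_divide_less_eq)
  then show False using growth[of k] bounded[of k] by linarith
qed

lemma eucl_norm_mult_mat_vec_bounded:
  fixes M :: "nat \<Rightarrow> real mat"
  assumes M: "\<And>k. M k \<in> carrier_mat n n"
    and bound: "\<And>k i j. i < n \<Longrightarrow> j < n \<Longrightarrow> \<bar>M k $$ (i, j)\<bar> \<le> c"
    and h: "h \<in> carrier_vec n"
  shows "\<exists>K. \<forall>k. eucl_norm (M k *\<^sub>v h) \<le> K"
proof (intro exI allI)
  fix k
  have "eucl_norm (M k *\<^sub>v h) \<le> (\<Sum>i = 0..<n. \<bar>(M k *\<^sub>v h) $ i\<bar>)"
    unfolding eucl_norm_L2_set using L2_set_le_sum_abs[of "\<lambda>i. (M k *\<^sub>v h) $ i" "{0..<n}"] M[of k]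
    by simp
  also have "\<dots> \<le> (\<Sum>i = 0..<n. \<Sum>j = 0..<n. c * \<bar>h $ j\<bar>)"
  proof (rule sum_mono)
    fix i assume i: "i \<in> {0..<n}"
    have "\<bar>(M k *\<^sub>v h) $ i\<bar> = \<bar>\<Sum>j = 0..<n. M k $$ (i, j) * h $ j\<bar>"
      using i h M[of k] by (simp add: scalar_prod_def)
    also have "\<dots> \<le> (\<Sum>j = 0..<n. c * \<bar>h $ j\<bar>)"
      using bound i
      by (intro order_trans[OF sum_abs] sum_mono) (auto simp: abs_mult intro!: mult_right_mono)
    finally show "\<bar>(M k *\<^sub>v h) $ i\<bar> \<le> (\<Sum>j = 0..<n. c * \<bar>h $ j\<bar>)" .
  qed
  finally show "eucl_norm (M k *\<^sub>v h) \<le> (\<Sum>i = 0..<n. \<Sum>j = 0..<n. c * \<bar>h $ j\<bar>)" .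
qed

text \<open>
  Moving one factor \<open>B\<close> across the scalar product turns \<open>|B\<^sup>k\<^sup>+\<^sup>1 h|\<^sup>2\<close> into \<open>B\<^sup>k h \<bullet> B\<^sup>k\<^sup>+\<^sup>2 h\<close>, and
  Cauchy-Schwarz makes \<open>|B\<^sup>k h|\<close> log-convex in \<open>k\<close>. It is bounded, because the Jordan normal form
  bounds the powers of a matrix whose spectral radius is below one.
\<close>

lemma symmetric_spectral_radius_less_one_nonexpansive:
  fixes B :: "real mat"
  assumes B: "B \<in> carrier_mat n n" and sym: "transpose_mat B = B"
    and sr: "spectral_radius (map_mat complex_of_real B) < 1"
    and h: "h \<in> carrier_vec n"
  shows "eucl_norm (B *\<^sub>v h) \<le> eucl_norm h"
proof -
  let ?x = "\<lambda>k. (B ^\<^sub>m k) *\<^sub>v h"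
  obtain c where c: "\<And>k. norm_bound ((map_mat complex_of_real B) ^\<^sub>m k) c"
    using spectral_radius_jnf_norm_bound_less_1_upper_triangular[OF _ sr] B by auto
  have "\<bar>(B ^\<^sub>m k) $$ (i, j)\<bar> \<le> c" if "i < n" "j < n" for k i j
    using c[of k] that B pow_carrier_mat[OF B, of k]
    by (auto simp: norm_bound_def simp flip: of_real_hom.mat_hom_pow[OF B])
  then obtain K where K: "\<And>k. eucl_norm (?x k) \<le> K"
    using eucl_norm_mult_mat_vec_bounded[of "\<lambda>k. B ^\<^sub>m k" n c h] B h by auto
  have x: "?x k \<in> carrier_vec n" for k
    using pow_carrier_mat[OF B, of k] h by simp
  have x_Suc: "?x (Suc k) = B *\<^sub>v ?x k" for k
  proof -
    have "B ^\<^sub>m Suc k = B * B ^\<^sub>m k"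
      by (induction k) (use B in \<open>auto simp: assoc_mult_mat[of _ n n _ n _ n]\<close>)
    then show ?thesis
      using B h by (metis assoc_mult_mat_vec pow_carrier_mat)
  qed
  have "(eucl_norm (?x (Suc k)))\<^sup>2 \<le> eucl_norm (?x k) * eucl_norm (?x (Suc (Suc k)))" for k
  proof -
    have "(eucl_norm (?x (Suc k)))\<^sup>2 = (B *\<^sub>v ?x k) \<bullet> ?x (Suc k)"
      unfolding eucl_norm_square x_Suc ..
    also have "\<dots> = ?x k \<bullet> ?x (Suc (Suc k))"
      using transpose_vec_mult_scalar[OF B x x, of k "Suc k"] unfolding sym x_Suc .
    finally show ?thesis
      using scalar_prod_le_eucl_norm[OF x x, of k "Suc (Suc k)"] by metis
  qed
  from log_convex_bounded_imp_le[of "\<lambda>k. eucl_norm (?x k)", OF _ this K]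
  show ?thesis using B h by simp
qed

text \<open>
  The strict inequality \<open>r < 1\<close>, uniformly in \<open>h\<close>, comes from applying nonexpansiveness to
  \<open>J / r\<close> instead of \<open>J\<close>, with \<open>r\<close> strictly between the spectral radius of \<open>J\<close> and one.
\<close>

lemma symmetric_spectral_radius_less_one_form:
  fixes J :: "real mat"
  assumes n: "0 < n" and J: "J \<in> carrier_mat n n" and sym: "transpose_mat J = J"
    and sr: "spectral_radius (map_mat complex_of_real J) < 1"
  shows "\<exists>r<1. \<forall>h \<in> carrier_vec n. h \<bullet> (J *\<^sub>v h) \<le> r * (eucl_norm h)\<^sup>2"
proof -
  let ?J = "map_mat complex_of_real J"
  have Jc: "?J \<in> carrier_mat n n" using J by simp
  define \<rho> where "\<rho> = spectral_radius ?J"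
  have \<rho>: "0 \<le> \<rho>" "\<rho> < 1"
    using spectral_radius_mem_max(1)[OF Jc n] sr by (auto simp: \<rho>_def)
  define r where "r = (\<rho> + 1) / 2"
  have r: "0 < r" "\<rho> < r" "r < 1" using \<rho> by (auto simp: r_def)
  define B where "B = (1 / r) \<cdot>\<^sub>m J"
  have B: "B \<in> carrier_mat n n" using J by (simp add: B_def)
  let ?B = "map_mat complex_of_real B"
  have Bc: "?B \<in> carrier_mat n n" using B by simp
  have BJ: "?B = complex_of_real (1 / r) \<cdot>\<^sub>m ?J"
    using J by (intro eq_matI) (auto simp: B_def)
  obtain e where e: "e \<in> spectrum ?B" "spectral_radius ?B = norm e"
    using spectral_radius_mem_max(1)[OF Bc n] by auto
  then obtain w where w: "w \<in> carrier_vec n" "w \<noteq> 0\<^sub>v n" "?B *\<^sub>v w = e \<cdot>\<^sub>v w"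
    using B by (auto simp: spectrum_def eigenvalue_def eigenvector_def)
  have "complex_of_real (1 / r) \<cdot>\<^sub>v (?J *\<^sub>v w) = e \<cdot>\<^sub>v w"
    using w J smult_mat_mult_vec[of w ?J "complex_of_real (1 / r)"] BJ by auto
  then have "of_real r \<cdot>\<^sub>v (complex_of_real (1 / r) \<cdot>\<^sub>v (?J *\<^sub>v w)) = of_real r \<cdot>\<^sub>v (e \<cdot>\<^sub>v w)"
    by simp
  then have "?J *\<^sub>v w = (of_real r * e) \<cdot>\<^sub>v w"
    using r by (simp add: smult_smult_assoc)
  then have "of_real r * e \<in> spectrum ?J"
    using w J by (auto simp: spectrum_def eigenvalue_def eigenvector_def)
  then have "norm (of_real r * e) \<le> \<rho>"
    unfolding \<rho>_def using spectral_radius_mem_max(2)[OF Jc n] by blast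
  then have "r * norm e \<le> \<rho>" using r by (simp add: norm_mult)
  then have "r * norm e < r * 1" using r by linarith
  then have sr_B: "spectral_radius ?B < 1" using e r by (metis mult_less_cancel_left_pos)
  have "transpose_mat B = (1 / r) \<cdot>\<^sub>m transpose_mat J"
    by (intro eq_matI) (auto simp: B_def)
  then have sym_B: "transpose_mat B = B" by (simp add: sym B_def)
  have "h \<bullet> (J *\<^sub>v h) \<le> r * (eucl_norm h)\<^sup>2" if h: "h \<in> carrier_vec n" for h
  proof -
    have "B *\<^sub>v h = (1 / r) \<cdot>\<^sub>v (J *\<^sub>v h)"
      using h J by (simp add: B_def smult_mat_mult_vec)
    then have "eucl_norm (J *\<^sub>v h) \<le> r * eucl_norm h"
      using symmetric_spectral_radius_less_one_nonexpansive[OF B sym_B sr_B h] r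
      by (simp add: eucl_norm_smult divide_le_eq mult.commute)
    then have "eucl_norm h * eucl_norm (J *\<^sub>v h) \<le> eucl_norm h * (r * eucl_norm h)"
      by (intro mult_left_mono) auto
    then show ?thesis
      using scalar_prod_le_eucl_norm[OF h, of "J *\<^sub>v h"] J h
      by (simp add: power2_eq_square mult.left_commute)
  qed
  then show ?thesis using r by blast
qed

section \<open>The multilinear form of a tensor\<close>

text \<open>
  The value of the multilinear form of \<open>S\<close> at the vectors \<open>x\<^sub>1, \<dots>, x\<^sub>m\<close>. The recursion contracts
  the first index, which leaves a tensor whose order is smaller by one. Hence facts about tensors
  of arbitrary order can be proved by induction, with the tensor generalized.
\<close>

fun contract :: "nat \<Rightarrow> tensor \<Rightarrow> real vec list \<Rightarrow> real" where
  "contract n S [] = S []"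
| "contract n S (x # xs) = (\<Sum>i<n. x $ i * contract n (\<lambda>is. S (i # is)) xs)"

lemma tensor_indices_0: "tensor_indices n 0 = {[]}"
  by (auto simp: tensor_indices_def)

lemma tensor_indices_Suc:
  "tensor_indices n (Suc m) = (\<lambda>(i, is). i # is) ` ({..<n} \<times> tensor_indices n m)"
  by (auto simp: tensor_indices_def length_Suc_conv image_iff)

lemma tensor_form_eq_contract: "tensor_form m n S v = contract n S (replicate m v)"
proof (induction m arbitrary: S)
  case 0
  then show ?case by (simp add: tensor_form_def tensor_indices_0)
next
  case (Suc m)
  have "tensor_form (Suc m) n S v =
      (\<Sum>(i, is) \<in> {..<n} \<times> tensor_indices n m. S (i # is) * (v $ i * (\<Prod>k\<leftarrow>is. v $ k)))"
    unfolding tensor_form_def tensor_indices_Suc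
    by (subst sum.reindex) (auto simp: inj_on_def intro!: sum.cong)
  also have "\<dots> = (\<Sum>i<n. v $ i * tensor_form m n (\<lambda>is. S (i # is)) v)"
    by (simp add: sum.cartesian_product[symmetric] tensor_form_def sum_distrib_left mult.left_commute)
  finally show ?case by (simp add: Suc)
qed

lemma scalar_prod_tensor_vec:
  "h \<bullet> tensor_vec (Suc m) n S v = contract n S (h # replicate m v)"
  by (simp add: scalar_prod_def tensor_vec_def tensor_form_def atLeast0LessThan
      flip: tensor_form_eq_contract)

lemma scalar_prod_tensor_mat:
  assumes "h \<in> carrier_vec n"
  shows "h \<bullet> (tensor_mat (Suc (Suc m)) n S v *\<^sub>v h) = contract n S (h # h # replicate m v)"
  using assms
  by (simp add: scalar_prod_def tensor_mat_def tensor_form_def atLeast0LessThan mult.commute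
      flip: tensor_form_eq_contract)

lemma contract_cong:
  assumes "\<And>is. is \<in> tensor_indices n (length xs) \<Longrightarrow> S is = S' is"
  shows "contract n S xs = contract n S' xs"
  using assms
proof (induction xs arbitrary: S S')
  case Nil
  then show ?case by (simp add: tensor_indices_0)
next
  case (Cons x xs)
  have "contract n (\<lambda>is. S (i # is)) xs = contract n (\<lambda>is. S' (i # is)) xs" if "i < n" for i
    using that Cons.prems by (intro Cons.IH) (auto simp: tensor_indices_Suc)
  then show ?case by simp
qed

lemma symmetric_tensor_slice:
  assumes "symmetric_tensor (Suc m) n S" and "i < n"
  shows "symmetric_tensor m n (\<lambda>is. S (i # is))"
  unfolding symmetric_tensor_def
proof (intro ballI impI)
  fix "is" js assume "is \<in> tensor_indices n m" "js \<in> tensor_indices n m" "mset is = mset js"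
  then have "i # is \<in> tensor_indices n (Suc m)" "i # js \<in> tensor_indices n (Suc m)"
    "mset (i # is) = mset (i # js)"
    using assms(2) by (auto simp: tensor_indices_Suc)
  then show "S (i # is) = S (i # js)"
    using assms(1) unfolding symmetric_tensor_def by blast
qed

lemma contract_swap:
  assumes "symmetric_tensor (Suc (Suc (length xs))) n S"
  shows "contract n S (x # y # xs) = contract n S (y # x # xs)"
proof -
  have eq: "contract n (\<lambda>is. S (i # j # is)) xs = contract n (\<lambda>is. S (j # i # is)) xs"
    if "i < n" "j < n" for i j
  proof (rule contract_cong)
    fix "is" assume "is \<in> tensor_indices n (length xs)"
    then have "i # j # is \<in> tensor_indices n (Suc (Suc (length xs)))"
      "j # i # is \<in> tensor_indices n (Suc (Suc (length xs)))"
      using that by (auto simp: tensor_indices_def)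
    then show "S (i # j # is) = S (j # i # is)"
      using assms unfolding symmetric_tensor_def by (metis add_mset_commute mset.simps(2))
  qed
  have "contract n S (x # y # xs) =
      (\<Sum>i<n. \<Sum>j<n. x $ i * (y $ j * contract n (\<lambda>is. S (i # j # is)) xs))"
    by (simp add: sum_distrib_left)
  also have "\<dots> = (\<Sum>j<n. \<Sum>i<n. y $ j * (x $ i * contract n (\<lambda>is. S (j # i # is)) xs))"
    by (subst sum.swap) (auto simp: eq mult.left_commute intro!: sum.cong)
  also have "\<dots> = contract n S (y # x # xs)"
    by (simp add: sum_distrib_left)
  finally show ?thesis .
qed

text \<open>
  The permutation invariance in the form in which the binomial theorem uses it: one argument
  moves past a block of others.
\<close>

lemma contract_insert:
  assumes "symmetric_tensor (Suc (length ys + length zs)) n S"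
  shows "contract n S (x # ys @ zs) = contract n S (ys @ x # zs)"
  using assms
proof (induction ys arbitrary: S)
  case (Cons y ys)
  have "contract n S (x # (y # ys) @ zs) = contract n S (y # x # ys @ zs)"
    using contract_swap[of "ys @ zs" n S x y] Cons.prems by simp
  also have "\<dots> = (\<Sum>i<n. y $ i * contract n (\<lambda>is. S (i # is)) (x # ys @ zs))"
    by (rule contract.simps(2))
  also have "\<dots> = (\<Sum>i<n. y $ i * contract n (\<lambda>is. S (i # is)) (ys @ x # zs))"
  proof (intro sum.cong refl)
    fix i assume "i \<in> {..<n}"
    then have "symmetric_tensor (Suc (length ys + length zs)) n (\<lambda>is. S (i # is))"
      using symmetric_tensor_slice[OF Cons.prems[simplified]] by simp
    then show "y $ i * contract n (\<lambda>is. S (i # is)) (x # ys @ zs) =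
        y $ i * contract n (\<lambda>is. S (i # is)) (ys @ x # zs)"
      by (simp only: Cons.IH)
  qed
  also have "\<dots> = contract n S ((y # ys) @ x # zs)"
    by simp
  finally show ?case .
qed simp

lemma contract_add_Cons:
  assumes "v \<in> carrier_vec n" and "h \<in> carrier_vec n"
  shows "contract n S ((v + h) # xs) = contract n S (v # xs) + contract n S (h # xs)"
  using assms by (simp add: sum.distrib distrib_right)

lemma pascal_sum:
  fixes F :: "nat \<Rightarrow> real"
  shows "(\<Sum>k\<le>m. real (m choose k) * (F k + F (Suc k))) = (\<Sum>k\<le>Suc m. real (Suc m choose k) * F k)"
proof -
  have "(\<Sum>k\<le>m. real (m choose k) * F k) = (\<Sum>k\<le>Suc m. real (m choose k) * F k)"
    by simp
  also have "\<dots> = F 0 + (\<Sum>k\<le>m. real (m choose Suc k) * F (Suc k))"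
    by (subst sum.atMost_Suc_shift) simp
  finally show ?thesis
    by (subst sum.atMost_Suc_shift) (simp add: algebra_simps sum.distrib)
qed

text \<open>
  Contracting the first index with \<open>v + h\<close> and expanding the remaining ones by the induction
  hypothesis yields terms with \<open>v\<close> or \<open>h\<close> in front. Symmetry sorts them into the normal form
  (all \<open>h\<close> before all \<open>v\<close>), and Pascal's rule adds up the coefficients.
\<close>

lemma contract_binomial:
  assumes "symmetric_tensor m n S" and v: "v \<in> carrier_vec n" and h: "h \<in> carrier_vec n"
  shows "contract n S (replicate m (v + h)) =
    (\<Sum>k\<le>m. real (m choose k) * contract n S (replicate k h @ replicate (m - k) v))"
  using assms(1)
proof (induction m arbitrary: S)
  case (Suc m)
  let ?u = "v + h"
  let ?w = "\<lambda>k. replicate k h @ replicate (m - k) v"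
  let ?F = "\<lambda>k. contract n S (replicate k h @ replicate (Suc m - k) v)"
  have F: "contract n S (?u # ?w k) = ?F k + ?F (Suc k)" if "k \<le> m" for k
  proof -
    have "contract n S (v # ?w k) = contract n S (replicate k h @ v # replicate (m - k) v)"
      using Suc.prems that by (intro contract_insert) simp
    then show ?thesis
      using that by (simp add: contract_add_Cons[OF v h] Suc_diff_le del: contract.simps)
  qed
  have "contract n S (replicate (Suc m) ?u) =
      (\<Sum>i<n. \<Sum>k\<le>m. ?u $ i * (real (m choose k) * contract n (\<lambda>is. S (i # is)) (?w k)))"
    by (simp add: Suc.IH[OF symmetric_tensor_slice[OF Suc.prems]] sum_distrib_left)
  also have "\<dots> = (\<Sum>k\<le>m. real (m choose k) * contract n S (?u # ?w k))"
    by (subst sum.swap) (simp add: sum_distrib_left mult.left_commute)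
  also have "\<dots> = (\<Sum>k\<le>m. real (m choose k) * (?F k + ?F (Suc k)))"
    by (intro sum.cong refl) (simp add: F del: contract.simps)
  also have "\<dots> = (\<Sum>k\<le>Suc m. real (Suc m choose k) * ?F k)"
    by (rule pascal_sum)
  finally show ?case .
qed simp

section \<open>Second-order expansion of the form\<close>

lemma contract_replicate_bound:
  "\<exists>C\<ge>0. \<forall>h \<in> carrier_vec n. \<bar>contract n S (replicate k h @ ys)\<bar> \<le> C * eucl_norm h ^ k"
proof (induction k arbitrary: S)
  case 0
  show ?case by (intro exI[of _ "\<bar>contract n S ys\<bar>"]) auto
next
  case (Suc k)
  from Suc[of "\<lambda>is. S (i # is)" for i] obtain C where C: "\<And>i. 0 \<le> C i"
    "\<And>i h. h \<in> carrier_vec n \<Longrightarrow>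
      \<bar>contract n (\<lambda>is. S (i # is)) (replicate k h @ ys)\<bar> \<le> C i * eucl_norm h ^ k"
    by metis
  have "\<bar>contract n S (replicate (Suc k) h @ ys)\<bar> \<le> (\<Sum>i<n. C i) * eucl_norm h ^ Suc k"
    if h: "h \<in> carrier_vec n" for h
  proof -
    have "\<bar>contract n S (replicate (Suc k) h @ ys)\<bar>
        \<le> (\<Sum>i<n. \<bar>h $ i * contract n (\<lambda>is. S (i # is)) (replicate k h @ ys)\<bar>)"
      by (simp add: sum_abs)
    also have "\<dots> \<le> (\<Sum>i<n. eucl_norm h * (C i * eucl_norm h ^ k))"
      unfolding abs_mult using h C
      by (intro sum_mono mult_mono) (auto intro: abs_index_le_eucl_norm)
    also have "\<dots> = (\<Sum>i<n. C i) * eucl_norm h ^ Suc k"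
      by (simp add: sum_distrib_left sum_distrib_right mult_ac)
    finally show ?thesis .
  qed
  then show ?case using C(1) by (intro exI[of _ "\<Sum>i<n. C i"]) (auto intro: sum_nonneg)
qed

text \<open>
  The terms of index 0, 1 and 2 of the binomial expansion are kept. The others carry at least
  three factors \<open>h\<close>, which for \<open>|h| \<le> 1\<close> bounds each of them by a multiple of \<open>|h|\<^sup>3\<close>.
\<close>

lemma tensor_form_expansion:
  assumes m: "2 \<le> m" and S: "symmetric_tensor m n S" and v: "v \<in> carrier_vec n"
  shows "\<exists>C\<ge>0. \<forall>h \<in> carrier_vec n. eucl_norm h \<le> 1 \<longrightarrow>
    tensor_form m n S (v + h) \<le> tensor_form m n S v + real m * (h \<bullet> tensor_vec m n S v)
      + real m * (real m - 1) / 2 * (h \<bullet> (tensor_mat m n S v *\<^sub>v h)) + C * eucl_norm h ^ 3"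
proof -
  obtain p where p: "m = Suc (Suc p)" using m by (metis Suc_diff_le add_2_eq_Suc le_Suc_ex)
  let ?D = "\<lambda>h k. contract n S (replicate k h @ replicate (m - k) v)"
  have "\<exists>C. \<forall>k. 0 \<le> C k \<and> (\<forall>h \<in> carrier_vec n. \<bar>?D h k\<bar> \<le> C k * eucl_norm h ^ k)"
    using contract_replicate_bound by (intro choice) blast
  then obtain C where C: "\<And>k. 0 \<le> C k"
    "\<And>k h. h \<in> carrier_vec n \<Longrightarrow> \<bar>?D h k\<bar> \<le> C k * eucl_norm h ^ k"
    by blast
  define C' where "C' = (\<Sum>k\<in>{3..m}. real (m choose k) * C k)"
  have "tensor_form m n S (v + h) \<le> tensor_form m n S v + real m * (h \<bullet> tensor_vec m n S v)
      + real m * (real m - 1) / 2 * (h \<bullet> (tensor_mat m n S v *\<^sub>v h)) + C' * eucl_norm h ^ 3"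
    if h: "h \<in> carrier_vec n" and small: "eucl_norm h \<le> 1" for h
  proof -
    have split: "{..m} = insert 0 (insert 1 (insert 2 {3..m}))" using m by auto
    have "tensor_form m n S (v + h) = (\<Sum>k\<le>m. real (m choose k) * ?D h k)"
      by (simp add: tensor_form_eq_contract contract_binomial[OF S v h])
    also have "\<dots> = ?D h 0 + real m * ?D h 1 + real (m choose 2) * ?D h 2
        + (\<Sum>k\<in>{3..m}. real (m choose k) * ?D h k)"
      unfolding split by simp
    also have "real (m choose 2) = real m * (real m - 1) / 2"
      by (simp add: p choose_two real_of_nat_div field_simps)
    also have "?D h 0 = tensor_form m n S v"
      by (simp add: tensor_form_eq_contract)
    also have "?D h 1 = h \<bullet> tensor_vec m n S v"
      by (simp add: p scalar_prod_tensor_vec del: contract.simps)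
    also have "?D h 2 = h \<bullet> (tensor_mat m n S v *\<^sub>v h)"
      using h by (simp add: p scalar_prod_tensor_mat numeral_2_eq_2 del: contract.simps)
    also have "(\<Sum>k\<in>{3..m}. real (m choose k) * ?D h k)
        \<le> (\<Sum>k\<in>{3..m}. real (m choose k) * C k * eucl_norm h ^ 3)"
    proof (rule sum_mono)
      fix k assume k: "k \<in> {3..m}"
      have "?D h k \<le> C k * eucl_norm h ^ k" using C(2)[OF h, of k] by linarith
      also have "\<dots> \<le> C k * eucl_norm h ^ 3"
        using k C(1) small by (intro mult_left_mono power_decreasing) auto
      finally show "real (m choose k) * ?D h k \<le> real (m choose k) * C k * eucl_norm h ^ 3"
        by (simp add: mult.assoc mult_left_mono)
    qed
    finally show ?thesis by (simp add: C'_def sum_distrib_right)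
  qed
  moreover have "0 \<le> C'" unfolding C'_def using C(1) by (intro sum_nonneg) auto
  ultimately show ?thesis by blast
qed

section \<open>Robust eigenpairs are local maxima\<close>

lemma power_map_jacobian_carrier: "power_map_jacobian m n S l v \<in> carrier_mat n n"
  by (intro carrier_matI) (simp_all add: power_map_jacobian_def)

lemma transpose_power_map_jacobian:
  assumes m: "2 \<le> m" and S: "symmetric_tensor m n S"
  shows "transpose_mat (power_map_jacobian m n S l v) = power_map_jacobian m n S l v"
proof -
  obtain p where p: "m = Suc (Suc p)" using m by (metis Suc_diff_le add_2_eq_Suc le_Suc_ex)
  have "S (i # j # is) = S (j # i # is)"
    if "i < n" "j < n" "is \<in> tensor_indices n p" for i j "is"
  proof -
    have "i # j # is \<in> tensor_indices n m" "j # i # is \<in> tensor_indices n m"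
      using that by (auto simp: p tensor_indices_def)
    then show ?thesis
      using S unfolding symmetric_tensor_def by (metis add_mset_commute mset.simps(2))
  qed
  then show ?thesis
    by (intro eq_matI) (auto simp: power_map_jacobian_def tensor_mat_def p intro!: sum.cong)
qed

lemma scalar_prod_power_map_jacobian:
  assumes v: "v \<in> carrier_vec n" and h: "h \<in> carrier_vec n"
  shows "h \<bullet> (power_map_jacobian m n S l v *\<^sub>v h) =
    (real m - 1) / l * (h \<bullet> (tensor_mat m n S v *\<^sub>v h) - l * (v \<bullet> h)\<^sup>2)"
proof -
  let ?A = "tensor_mat m n S v"
  let ?P = "mat n n (\<lambda>(i, j). v $ i * v $ j)"
  have A: "?A \<in> carrier_mat n n" by (simp add: tensor_mat_def)
  have "?P *\<^sub>v h = (v \<bullet> h) \<cdot>\<^sub>v v"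
    using v h by (intro eq_vecI) (auto simp: scalar_prod_def sum_distrib_left algebra_simps)
  then have "power_map_jacobian m n S l v *\<^sub>v h =
      ((real m - 1) / l) \<cdot>\<^sub>v (?A *\<^sub>v h - l \<cdot>\<^sub>v ((v \<bullet> h) \<cdot>\<^sub>v v))"
    unfolding power_map_jacobian_def using A h
    by (simp add: smult_mat_mult_vec minus_mult_distrib_mat_vec[of _ n n])
  then show ?thesis
    using A v h comm_scalar_prod[OF v h]
    by (simp add: scalar_prod_minus_distrib[of _ n] power2_eq_square mult.assoc)
qed

text \<open>
  At an eigenvector the power map returns \<open>(l / |l|) v\<close>.
\<close>

lemma robust_imp_pos:
  assumes "robust m n S l v"
  shows "0 < l"
proof -
  have ev: "tensor_vec m n S v = l \<cdot>\<^sub>v v" and vv: "v \<bullet> v = 1" and l: "l \<noteq> 0"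
    and fixed: "power_map m n S v = v"
    using assms by (auto simp: robust_def eigenpair_def)
  have "eucl_norm v = 1" using vv by (simp add: eucl_norm_def)
  then have "v = (l / \<bar>l\<bar>) \<cdot>\<^sub>v v"
    using fixed by (simp add: power_map_def ev eucl_norm_smult smult_smult_assoc)
  then have "v \<bullet> v = v \<bullet> ((l / \<bar>l\<bar>) \<cdot>\<^sub>v v)" by simp
  then have "l / \<bar>l\<bar> = 1" using vv by simp
  then show ?thesis using l by (simp add: abs_if split: if_splits)
qed

text \<open>
  Two unit vectors differ by a vector that is tangent to the sphere up to second order. This is
  where the constraint \<open>u \<bullet> u = 1\<close> enters.
\<close>

lemma unit_diff_scalar_prod:
  assumes v: "v \<in> carrier_vec n" and u: "u \<in> carrier_vec n" and "v \<bullet> v = 1" "u \<bullet> u = 1"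
  shows "v \<bullet> (u - v) = - (eucl_norm (u - v))\<^sup>2 / (2::real)"
proof -
  have "(u - v) \<bullet> (u - v) = 2 - 2 * (v \<bullet> u)"
    using assms comm_scalar_prod[OF v u]
    by (simp add: scalar_prod_minus_distrib[of _ n] minus_scalar_prod_distrib[of _ n])
  then show ?thesis
    unfolding eucl_norm_square using assms by (simp add: scalar_prod_minus_distrib[of _ n])
qed

text \<open>
  With \<open>s = |u - v|\<close> the expansion becomes \<open>S u\<^sup>m - S v\<^sup>m \<le> - a s\<^sup>2 + b s\<^sup>4 + C s\<^sup>3\<close>: the constant
  \<open>a > 0\<close> is the gap left by the spectral radius, \<open>b\<close> accounts for the rank-one part
  \<open>l v v\<^sup>T\<close> of the Jacobian, and \<open>C\<close> is the constant of the Taylor remainder. So \<open>(b + C) s \<le> a\<close>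
  is close enough.
\<close>

theorem robust_imp_locally_maximal:
  assumes m: "2 \<le> m" and n: "1 \<le> n" and S: "symmetric_tensor m n S"
    and robust: "robust m n S l v"
  shows "locally_maximal m n S v"
proof -
  let ?J = "power_map_jacobian m n S l v"
  have v: "v \<in> carrier_vec n" and ev: "tensor_vec m n S v = l \<cdot>\<^sub>v v" and vv: "v \<bullet> v = 1"
    and sr: "spectral_radius (map_mat complex_of_real ?J) < 1"
    using robust by (auto simp: robust_def eigenpair_def)
  have l: "0 < l" by (rule robust_imp_pos[OF robust])
  have J: "?J \<in> carrier_mat n n" by (rule power_map_jacobian_carrier)
  have "0 < n" using n by simp
  from symmetric_spectral_radius_less_one_form[OF this J transpose_power_map_jacobian[OF m S] sr]
  obtain r where r: "r < 1" and Jr: "\<And>h. h \<in> carrier_vec n \<Longrightarrow> h \<bullet> (?J *\<^sub>v h) \<le> r * (eucl_norm h)\<^sup>2"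
    by blast
  obtain C where C: "0 \<le> C" and expansion: "\<And>h. h \<in> carrier_vec n \<Longrightarrow> eucl_norm h \<le> 1 \<Longrightarrow>
    tensor_form m n S (v + h) \<le> tensor_form m n S v + real m * (h \<bullet> tensor_vec m n S v)
      + real m * (real m - 1) / 2 * (h \<bullet> (tensor_mat m n S v *\<^sub>v h)) + C * eucl_norm h ^ 3"
    using tensor_form_expansion[OF m S v] by blast
  define a where "a = real m * l * (1 - r) / 2"
  define b where "b = real m * (real m - 1) * l / 8"
  define K where "K = b + C"
  have a: "0 < a" using m l r by (simp add: a_def)
  have K: "0 \<le> K" using m l C by (simp add: K_def b_def)
  define e where "e = min 1 (a / (K + 1))"
  have e: "0 < e" using a K by (simp add: e_def)
  have "tensor_form m n S u \<le> tensor_form m n S v"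
    if u: "u \<in> carrier_vec n" and uu: "u \<bullet> u = 1" and close: "eucl_norm (u - v) < e" for u
  proof -
    define h where "h = u - v"
    define s where "s = eucl_norm h"
    have h: "h \<in> carrier_vec n" using u v by (simp add: h_def)
    have u_eq: "u = v + h" using u v by (auto simp: h_def)
    have s: "0 \<le> s" "s \<le> 1" "s < a / (K + 1)"
      using close by (auto simp: s_def h_def e_def)
    have vh: "v \<bullet> h = - s\<^sup>2 / 2"
      using unit_diff_scalar_prod[OF v u vv uu] by (simp add: s_def h_def)
    have first: "h \<bullet> tensor_vec m n S v = - l * s\<^sup>2 / 2"
      using vh v h comm_scalar_prod[OF v h] by (simp add: ev)
    let ?q = "h \<bullet> (tensor_mat m n S v *\<^sub>v h)"
    (* The summand s ^ 4 / 4 is the square of v \<bullet> h. *)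
    have "(real m - 1) / l * (?q - l * (s ^ 4 / 4)) \<le> r * s\<^sup>2"
      using Jr[OF h] unfolding scalar_prod_power_map_jacobian[OF v h] vh
      by (simp add: s_def power_divide flip: power_mult)
    then have "(real m - 1) * ?q \<le> l * r * s\<^sup>2 + (real m - 1) * l * s ^ 4 / 4"
      using l by (simp add: field_simps)
    then have "real m / 2 * ((real m - 1) * ?q)
        \<le> real m / 2 * (l * r * s\<^sup>2 + (real m - 1) * l * s ^ 4 / 4)"
      by (rule mult_left_mono) simp
    moreover have "tensor_form m n S u \<le> tensor_form m n S v + real m * (- l * s\<^sup>2 / 2)
        + real m * (real m - 1) / 2 * ?q + C * s ^ 3"
      using expansion[OF h] s by (simp add: u_eq s_def first)
    ultimately have "tensor_form m n S u \<le> tensor_form m n S v - a * s\<^sup>2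
        + b * s ^ 4 + C * s ^ 3"
      by (simp add: a_def b_def field_simps)
    moreover have "b * s ^ 4 \<le> b * s ^ 3"
      unfolding b_def using s m l by (intro mult_left_mono power_decreasing) auto
    ultimately have "tensor_form m n S u \<le> tensor_form m n S v - s\<^sup>2 * (a - K * s)"
      by (simp add: K_def algebra_simps power2_eq_square power3_eq_cube)
    moreover have "K * s \<le> a"
    proof -
      have "K * s \<le> (K + 1) * s" using s by (simp add: mult_right_mono)
      also have "\<dots> \<le> a" using s K by (simp add: field_simps)
      finally show ?thesis .
    qed
    then have "0 \<le> s\<^sup>2 * (a - K * s)" by simp
    ultimately show ?thesis by linarith
  qed
  then show ?thesis using v vv e unfolding locally_maximal_def by blast
qed

section \<open>A local maximum that is not robust\<close>

text \<open>The Kronecker delta, read as a tensor of order two in any dimension.\<close>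

definition identity_tensor :: tensor where
  "identity_tensor is = (if is ! 0 = is ! 1 then 1 else 0)"

lemma symmetric_identity_tensor: "symmetric_tensor 2 n identity_tensor"
  unfolding symmetric_tensor_def
proof (intro ballI impI)
  fix "is" js assume "is \<in> tensor_indices n 2" "js \<in> tensor_indices n 2" and eq: "mset is = mset js"
  then obtain i j k l where ij: "is = [i, j]" "js = [k, l]"
    unfolding tensor_indices_def mem_Collect_eq numeral_2_eq_2 length_Suc_conv length_0_conv by metis
  then have "(i = k \<and> j = l) \<or> (i = l \<and> j = k)"
    using mset_eq_setD[OF eq] by (simp add: doubleton_eq_iff)
  then show "identity_tensor is = identity_tensor js"
    by (auto simp: ij identity_tensor_def)
qed

lemma tensor_vec_identity_tensor:
  assumes "u \<in> carrier_vec n"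
  shows "tensor_vec 2 n identity_tensor u = u"
proof -
  have "(\<Sum>is \<in> tensor_indices n 1. identity_tensor (j # is) * (\<Prod>i\<leftarrow>is. u $ i)) = u $ j"
    if "j < n" for j
  proof -
    have "(\<Sum>is \<in> tensor_indices n 1. identity_tensor (j # is) * (\<Prod>i\<leftarrow>is. u $ i)) =
        tensor_form 1 n (\<lambda>is. identity_tensor (j # is)) u"
      by (simp add: tensor_form_def)
    also have "\<dots> = u $ j"
      using that
      by (simp add: tensor_form_eq_contract identity_tensor_def if_distrib[of "\<lambda>x. _ * x"] cong: if_cong)
    finally show ?thesis .
  qed
  then show ?thesis using assms by (intro eq_vecI) (auto simp: tensor_vec_def)
qed

lemma tensor_form_identity_tensor:
  assumes "u \<in> carrier_vec n"
  shows "tensor_form 2 n identity_tensor u = u \<bullet> u"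
  using scalar_prod_tensor_vec[of u 1 n identity_tensor u] tensor_vec_identity_tensor[OF assms]
  by (simp add: tensor_form_eq_contract numeral_2_eq_2)

lemma identity_tensor_locally_maximal:
  assumes "v \<in> carrier_vec n" and "v \<bullet> v = 1"
  shows "locally_maximal 2 n identity_tensor v"
  unfolding locally_maximal_def using assms
  by (auto simp: tensor_form_identity_tensor intro: exI[of _ 1])

text \<open>
  The Jacobian is the orthogonal projection onto the complement of the eigenvector. Two dimensions
  are needed for this complement to contain an eigenvector of eigenvalue one.
\<close>

lemma identity_tensor_not_robust:
  "\<not> robust 2 2 identity_tensor 1 (unit_vec 2 0)"
proof -
  let ?J = "map_mat complex_of_real (power_map_jacobian 2 2 identity_tensor 1 (unit_vec 2 0))"
  have J: "?J \<in> carrier_mat 2 2" by (simp add: power_map_jacobian_carrier)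
  have "?J *\<^sub>v unit_vec 2 1 = 1 \<cdot>\<^sub>v unit_vec 2 1"
  proof (rule eq_vecI)
    fix i assume "i < dim_vec (1 \<cdot>\<^sub>v unit_vec 2 1 :: complex vec)"
    then have i: "i < 2" by simp
    then have "(?J *\<^sub>v unit_vec 2 1) $ i = row ?J i \<bullet> unit_vec 2 1"
      using J by (intro index_mult_mat_vec) simp
    also have "\<dots> = ?J $$ (i, 1)"
      using i J row_carrier[of ?J i] by (subst scalar_prod_right_unit[of _ 2]) auto
    also have "\<dots> = (1 \<cdot>\<^sub>v unit_vec 2 1) $ i"
      using i by (simp add: power_map_jacobian_def tensor_mat_def tensor_indices_0 identity_tensor_def)
    finally show "(?J *\<^sub>v unit_vec 2 1) $ i = (1 \<cdot>\<^sub>v unit_vec 2 1) $ i" .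
  qed (use J in simp)
  then have "eigenvector ?J (unit_vec 2 1) 1"
    using J by (auto simp: eigenvector_def)
  then have "1 \<in> norm ` spectrum ?J"
    by (force simp: spectrum_def eigenvalue_def)
  then have "1 \<le> spectral_radius ?J"
    by (intro spectral_radius_mem_max(2)[OF J]) auto
  then show ?thesis by (simp add: robust_def)
qed

theorem lemma1:
  shows "(\<forall>m n S l v. 2 \<le> m \<longrightarrow> 1 \<le> n \<longrightarrow> symmetric_tensor m n S \<longrightarrow> eigenpair m n S l v \<longrightarrow>
            robust m n S l v \<longrightarrow> locally_maximal m n S v) \<and>
         (\<exists>m n S l v. 2 \<le> m \<and> 1 \<le> n \<and> symmetric_tensor m n S \<and> eigenpair m n S l v \<and> l \<noteq> 0 \<and>
            locally_maximal m n S v \<and> \<not> robust m n S l v)"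
proof (intro conjI)
  let ?e = "unit_vec 2 0 :: real vec"
  have "?e \<in> carrier_vec 2" "?e \<bullet> ?e = 1" by simp_all
  then have "eigenpair 2 2 identity_tensor 1 ?e" "locally_maximal 2 2 identity_tensor ?e"
    by (auto simp: eigenpair_def tensor_vec_identity_tensor identity_tensor_locally_maximal)
  then show "\<exists>m n S l v. 2 \<le> m \<and> 1 \<le> n \<and> symmetric_tensor m n S \<and> eigenpair m n S l v \<and> l \<noteq> 0 \<and>
      locally_maximal m n S v \<and> \<not> robust m n S l v"
    using symmetric_identity_tensor[of 2] identity_tensor_not_robust
    by (intro exI[of _ 2] exI[of _ identity_tensor] exI[of _ "1::real"] exI[of _ ?e]) auto
qed (auto intro: robust_imp_locally_maximal)

end
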